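(* Let $k$ and $\ell$ be integers with $k\ge 3$ and $\ell\ge 5$. Then $S_{2(\ell+k),2k}(A,B)$ is not cyclically equivalent to a sum of Hermitian squares in $\mathbf{R}\langle X,Y\rangle$, where $A=X^2$ and $B=Y^2$.
   Context: $\mathbf{R}\langle X,Y\rangle$ is the algebra of real polynomials in noncommuting variables $X$ and $Y$, endowed with the linear, anti-multiplicative involution $*$ such that $X^*=X$ and $Y^*=Y$. Put $A=X^2$ and $B=Y^2$. For integers $m\ge k\ge 0$, $S_{m,k}(A,B)$ denotes the sum of all words of length $m$ in the letters $A$ and $B$ having exactly $k$ letters equal to $B$ and $m-k$ letters equal to $A$, regarded as an element of $\mathbf{R}\langle X,Y\rangle$. A Hermitian square is an element of the form $f^*f$ with $f\in\mathbf{R}\langle X,Y\rangle$; sums are finite. Two elements $a,b\in\mathbf{R}\langle X,Y\rangle$ are cyclically equivalent if $a-b$ is a finite sum of commutators $[g,h]=gh-hg$ with $g,h\in\mathbf{R}\langle X,Y\rangle$. *)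

theory Defs
  imports Complex_Main "HOL-Library.Poly_Mapping"
begin

text \<open>
  The free algebra on \<open>X\<close>, \<open>Y\<close> is the monoid algebra of the free monoid on two letters:
  \<open>Poly_Mapping\<close> turns finitely supported functions on an additive (not necessarily
  commutative) monoid into a ring under convolution. The free monoid is therefore written
  additively; \<open>u + v\<close> is the concatenation of words and \<open>0\<close> is the empty word.
\<close>

datatype letter = LX | LY

datatype word = Word (letters: "letter list")

instantiation word :: monoid_add
begin

definition zero_word :: word where
  "0 = Word []"

definition plus_word :: "word \<Rightarrow> word \<Rightarrow> word" where
  "u + v = Word (letters u @ letters v)"

instance
  by standard (simp_all add: zero_word_def plus_word_def)

end

type_synonym ncpoly = "word \<Rightarrow>\<^sub>0 real"

definition ncX :: ncpoly where
  "ncX = Poly_Mapping.single (Word [LX]) 1"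

definition ncY :: ncpoly where
  "ncY = Poly_Mapping.single (Word [LY]) 1"

definition word_rev :: "word \<Rightarrow> word" where
  "word_rev w = Word (rev (letters w))"

lemma word_rev_word_rev [simp]: "word_rev (word_rev w) = w"
  by (simp add: word_rev_def)

lemma word_rev_add: "word_rev (u + v) = word_rev v + word_rev u"
  by (simp add: word_rev_def plus_word_def)

lemma inj_word_rev: "inj word_rev"
  by (metis injI word_rev_word_rev)

text \<open>
  The coefficient of \<open>w\<close> in \<open>star f\<close> is that of the reversed word in \<open>f\<close>. The lemmas below
  show that this is the involution determined by linearity, anti-multiplicativity and
  the fixed generators.
\<close>

definition star :: "ncpoly \<Rightarrow> ncpoly" where
  "star f = Poly_Mapping.map_key word_rev f"

lemma star_single: "star (Poly_Mapping.single w c) = Poly_Mapping.single (word_rev w) c"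
  using map_key_single [OF inj_word_rev, of "word_rev w" c] by (simp add: star_def)

lemma star_add: "star (f + g) = star f + star g"
  by (simp add: star_def map_key_plus [OF inj_word_rev])

lemma star_zero [simp]: "star 0 = 0"
  by (simp add: star_def map_key_zero [OF inj_word_rev])

lemma star_ncX: "star ncX = ncX" and star_ncY: "star ncY = ncY"
  by (simp_all add: ncX_def ncY_def star_single word_rev_def)

lemma star_star: "star (star f) = f"
proof -
  have "word_rev \<circ> word_rev = (\<lambda>w. w)"
    by (simp add: fun_eq_iff)
  then show ?thesis
    by (simp add: star_def map_key_compose [OF inj_word_rev inj_word_rev] map_key_id)
qed

lemma ncpoly_induct [case_names zero add]:
  fixes f :: ncpoly
  assumes "P 0" and step: "\<And>w c f. P f \<Longrightarrow> P (Poly_Mapping.single w c + f)"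
  shows "P f"
proof (induction f rule: update_induct)
  case const
  show ?case by fact
next
  case (update f w c)
  have "Poly_Mapping.update w c f = Poly_Mapping.single w c + f"
    using update.hyps
    by (intro poly_mapping_eqI)
      (auto simp: lookup_add lookup_update lookup_single when_def in_keys_iff)
  then show ?case using step [OF update.IH] by simp
qed

lemma star_mult: "star (f * g) = star g * star f"
proof (induction f rule: ncpoly_induct)
  case zero
  show ?case by simp
next
  case (add w c f)
  have "star (Poly_Mapping.single w c * g) = star g * star (Poly_Mapping.single w c)"
    by (induction g rule: ncpoly_induct)
      (simp_all add: star_add star_single distrib_left distrib_right mult_single word_rev_add
        mult.commute)
  then show ?case using add by (simp add: star_add distrib_left distrib_right)
qed

lemma star_scale:
  "star (Poly_Mapping.single 0 c * f) = Poly_Mapping.single 0 c * star f"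
  by (induction f rule: ncpoly_induct)
    (simp_all add: star_add star_single distrib_left mult_single)

text \<open>
  A word of length \<open>m\<close> in the letters \<open>A\<close>, \<open>B\<close> is a list of truth values of length \<open>m\<close>,
  with \<open>True\<close> standing for \<open>B\<close>. The sum runs over formal words, not over their values.
\<close>

definition word_value :: "'a::monoid_mult \<Rightarrow> 'a \<Rightarrow> bool list \<Rightarrow> 'a" where
  "word_value A B w = prod_list (map (\<lambda>b. if b then B else A) w)"

definition S :: "nat \<Rightarrow> nat \<Rightarrow> 'a::semiring_1 \<Rightarrow> 'a \<Rightarrow> 'a" where
  "S m k A B = (\<Sum>w | length w = m \<and> count_list w True = k. word_value A B w)"

lemma finite_S_index: "finite {w. length w = m \<and> count_list w True = k}"
  by (rule finite_subset [OF _ finite_lists_length_eq [OF finite, of "UNIV :: bool set" m]]) auto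

definition sum_hermitian_squares :: "ncpoly \<Rightarrow> bool" where
  "sum_hermitian_squares p \<longleftrightarrow>
    (\<exists>(n::nat) (f :: nat \<Rightarrow> ncpoly). p = (\<Sum>i<n. star (f i) * f i))"

definition commutator :: "'a::ring \<Rightarrow> 'a \<Rightarrow> 'a" where
  "commutator g h = g * h - h * g"

definition cyclically_equivalent :: "ncpoly \<Rightarrow> ncpoly \<Rightarrow> bool" where
  "cyclically_equivalent a b \<longleftrightarrow>
    (\<exists>(n::nat) (g :: nat \<Rightarrow> ncpoly) (h :: nat \<Rightarrow> ncpoly).
      a - b = (\<Sum>i<n. commutator (g i) (h i)))"

end

theory Submission
  imports Defs
begin

text \<open>
  Suppose \<open>S\<close> is cyclically equivalent to \<open>\<Sum> f\<^sub>i\<^sup>* f\<^sub>i\<close>. Two families of linear functionals that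
  vanish on commutators are applied to this relation.

  The first family bounds degrees. Let a path carry the letters of a word \<open>w\<close> on its edges, and let
  \<open>X\<close> and \<open>Y\<close> act as the adjacency matrices of the edges with the respective letter. These are
  symmetric matrices, and among words no longer than \<open>w\<close> only \<open>w\<close> itself has a nonzero corner entry.
  If some \<open>f\<^sub>i\<close> had a word with more than \<open>2 * l\<close> letters \<open>X\<close>, then with \<open>w\<close> extremal the trace of
  the top part of \<open>\<Sum> f\<^sub>i\<^sup>* f\<^sub>i\<close> would be positive, whereas \<open>S\<close> has nothing in that degree
  (\<open>degree_bound\<close>). The same holds for \<open>Y\<close>. So a word of \<open>S\<close>, which has \<open>4 * l\<close> letters \<open>X\<close> and
  \<open>4 * k\<close> letters \<open>Y\<close>, arises from \<open>f\<^sub>i\<^sup>* f\<^sub>i\<close> only by a cut into two halves of equal content.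

  The second family sums the coefficients over all rotations of one word. With the Gram matrix
  \<open>gram\<close> of the coefficient vectors of words (a word and its reversal taken together), the relation
  says: for every cyclic word in \<open>X\<^sup>2\<close> and \<open>Y\<^sup>2\<close> of the right content, the Gram entries over its
  balanced cuts add up to \<open>2 * (l + k)\<close> (\<open>gram_balanced_cuts\<close>). Now write \<open>A = X\<^sup>2\<close>, \<open>B = Y\<^sup>2\<close> and take
  \<open>e = A\<^sup>l B\<^sup>k\<close>, \<open>b = A\<^bsup>l-2\<^esup> B\<^bsup>k-1\<^esup> A\<^sup>2 B\<close>, \<open>c = A B\<^sup>2 A\<^bsup>l-1\<^esup> B\<^bsup>k-2\<^esup>\<close> and \<open>d = A B\<^bsup>k-1\<^esup> A\<^bsup>l-1\<^esup> B\<close>.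
  The cyclic words \<open>e\<^sup>*e\<close>, \<open>e\<^sup>*b\<close>, \<open>b\<^sup>*b\<close>, \<open>e\<^sup>*c\<close> have no balanced cut besides the obvious one, so these
  four Gram entries equal \<open>n = 2 * (l + k)\<close>. Hence \<open>e\<close> and \<open>b\<close> have equal vectors and
  \<open>gram b c = gram e c = n\<close>. But \<open>d\<^sup>*d\<close> also has two cuts into \<open>b\<close> and \<open>c\<close>, which gives
  \<open>gram d d + 2 * gram b c = n\<close>, so \<open>gram d d = - n < 0\<close>, which is absurd. The bounds on \<open>k\<close> and \<open>l\<close>
  enter in the absence of further balanced cuts: for \<open>l = 4\<close> the word \<open>b\<^sup>*b\<close> acquires new ones.
\<close>

section \<open>Linear functionals on the free algebra\<close>

definition pairing :: "(word \<Rightarrow> real) \<Rightarrow> ncpoly \<Rightarrow> real" where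
  "pairing \<phi> g = (\<Sum>x\<in>Poly_Mapping.keys g. Poly_Mapping.lookup g x * \<phi> x)"

lemma pairing_superset:
  assumes "finite A" "Poly_Mapping.keys g \<subseteq> A"
  shows "pairing \<phi> g = (\<Sum>x\<in>A. Poly_Mapping.lookup g x * \<phi> x)"
  unfolding pairing_def
  by (rule sum.mono_neutral_left) (use assms in \<open>auto simp: in_keys_iff\<close>)

lemma pairing_zero [simp]: "pairing \<phi> 0 = 0"
  by (simp add: pairing_def)

lemma pairing_single [simp]: "pairing \<phi> (Poly_Mapping.single w c) = c * \<phi> w"
  by (simp add: pairing_def)

lemma pairing_add: "pairing \<phi> (g + h) = pairing \<phi> g + pairing \<phi> h"
proof -
  let ?A = "Poly_Mapping.keys g \<union> Poly_Mapping.keys h"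
  have "pairing \<phi> (g + h) = (\<Sum>x\<in>?A. Poly_Mapping.lookup (g + h) x * \<phi> x)"
    by (rule pairing_superset) (use Poly_Mapping.keys_add[of g h] in auto)
  also have "\<dots> = (\<Sum>x\<in>?A. Poly_Mapping.lookup g x * \<phi> x) + (\<Sum>x\<in>?A. Poly_Mapping.lookup h x * \<phi> x)"
    by (simp add: lookup_add distrib_right sum.distrib)
  also have "\<dots> = pairing \<phi> g + pairing \<phi> h"
    using pairing_superset[of ?A g \<phi>] pairing_superset[of ?A h \<phi>] by simp
  finally show ?thesis .
qed

lemma pairing_diff: "pairing \<phi> (g - h) = pairing \<phi> g - pairing \<phi> h"
  using pairing_add[of \<phi> "g - h" h] by simp

lemma pairing_sum: "pairing \<phi> (\<Sum>i\<in>I. g i) = (\<Sum>i\<in>I. pairing \<phi> (g i))"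
  by (induction I rule: infinite_finite_induct) (simp_all add: pairing_add)

lemma pairing_mult: "pairing \<phi> (g * h) = pairing (\<lambda>u. pairing (\<lambda>v. \<phi> (u + v)) h) g"
proof (induction g rule: ncpoly_induct)
  case zero
  show ?case by simp
next
  case (add w c g)
  have "pairing \<phi> (Poly_Mapping.single w c * h) = c * pairing (\<lambda>v. \<phi> (w + v)) h"
    by (induction h rule: ncpoly_induct)
      (simp_all add: distrib_left pairing_add mult_single mult.assoc)
  then show ?case
    using add by (simp add: distrib_right pairing_add)
qed

lemma pairing_star: "pairing \<phi> (star f) = pairing (\<lambda>u. \<phi> (word_rev u)) f"
  by (induction f rule: ncpoly_induct) (simp_all add: star_add star_single pairing_add)

lemma pairing_hermitian_square:
  "pairing \<phi> (star f * f) =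
    (\<Sum>u\<in>Poly_Mapping.keys f. \<Sum>v\<in>Poly_Mapping.keys f.
      Poly_Mapping.lookup f u * Poly_Mapping.lookup f v * \<phi> (word_rev u + v))"
  by (simp add: pairing_mult pairing_star)
    (simp add: pairing_def sum_distrib_left mult.assoc)

lemma pairing_commutator:
  assumes "\<And>u v. \<phi> (u + v) = \<phi> (v + u)"
  shows "pairing \<phi> (commutator g h) = 0"
proof -
  have "pairing \<phi> (g * h) = pairing \<phi> (h * g)"
    unfolding pairing_mult unfolding pairing_def
    by (simp add: sum_distrib_left mult.left_commute)
      (subst sum.swap, simp add: assms)
  then show ?thesis by (simp add: commutator_def pairing_diff)
qed

text \<open>
  Everything below extracts information from a decomposition by choosing \<open>\<phi>\<close> in this identity: the
  right-hand side sees only \<open>s\<close>, and the left-hand side is a quadratic form in the coefficients.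
\<close>

lemma pairing_cyclic_hermitian:
  assumes "\<And>u v. \<phi> (u + v) = \<phi> (v + u)"
    and "cyclically_equivalent s (\<Sum>i<N. star (f i) * f i)"
  shows "(\<Sum>i<N. \<Sum>u\<in>Poly_Mapping.keys (f i). \<Sum>v\<in>Poly_Mapping.keys (f i).
      Poly_Mapping.lookup (f i) u * Poly_Mapping.lookup (f i) v * \<phi> (word_rev u + v))
    = pairing \<phi> s"
proof -
  obtain m :: nat and g h where
    "s - (\<Sum>i<N. star (f i) * f i) = (\<Sum>i<m. commutator (g i) (h i))"
    using assms(2) unfolding cyclically_equivalent_def by blast
  then have "pairing \<phi> (s - (\<Sum>i<N. star (f i) * f i)) = 0"
    by (simp add: pairing_sum pairing_commutator assms(1))
  then show ?thesis
    by (simp add: pairing_diff pairing_sum pairing_hermitian_square)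
qed

section \<open>The degree bound\<close>

text \<open>
  The entry at \<open>(a, b)\<close> of the matrix of the word \<open>x\<close>, when each letter acts on the vertices
  \<open>0, \<dots>, length w\<close> of a path as the adjacency matrix of the edges bearing that letter; the edge
  between \<open>d\<close> and \<open>d + 1\<close> bears \<open>w ! d\<close>.
\<close>

fun walks :: "letter list \<Rightarrow> letter list \<Rightarrow> nat \<Rightarrow> nat \<Rightarrow> real" where
  "walks w [] a b = of_bool (a = b)"
| "walks w (c # x) a b = (\<Sum>d\<le>length w.
     of_bool (d = Suc a \<and> w ! a = c \<or> a = Suc d \<and> w ! d = c) * walks w x d b)"

lemma walks_append:
  assumes "a \<le> length w"
  shows "walks w (x @ y) a b = (\<Sum>d\<le>length w. walks w x a d * walks w y d b)"
  using assms
proof (induction x arbitrary: a)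
  case Nil
  then show ?case by simp
next
  case (Cons c x)
  let ?E = "\<lambda>d. of_bool (d = Suc a \<and> w ! a = c \<or> a = Suc d \<and> w ! d = c) :: real"
  have "walks w ((c # x) @ y) a b
      = (\<Sum>d\<le>length w. \<Sum>d'\<le>length w. ?E d * (walks w x d d' * walks w y d' b))"
    using Cons.IH by (simp add: sum_distrib_left)
  also have "\<dots> = (\<Sum>d'\<le>length w. \<Sum>d\<le>length w. ?E d * (walks w x d d' * walks w y d' b))"
    by (rule sum.swap)
  also have "\<dots> = (\<Sum>d'\<le>length w. walks w (c # x) a d' * walks w y d' b)"
    by (simp add: sum_distrib_right mult.assoc)
  finally show ?case .
qed

text \<open>The generators act by symmetric matrices, so reversing a word transposes its matrix.\<close>

lemma walks_rev:
  assumes "a \<le> length w" "b \<le> length w"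
  shows "walks w (rev x) a b = walks w x b a"
  using assms
proof (induction x arbitrary: a b)
  case Nil
  then show ?case by auto
next
  case (Cons c x)
  have "walks w [c] d b = of_bool (d = Suc b \<and> w ! b = c \<or> b = Suc d \<and> w ! d = c)" for d
  proof -
    have "walks w [c] d b = (\<Sum>d'\<le>length w.
        if d' = b then of_bool (d' = Suc d \<and> w ! d = c \<or> d = Suc d' \<and> w ! d' = c) else 0)"
      by (simp only: walks.simps) (rule sum.cong, auto)
    also have "\<dots> = of_bool (d = Suc b \<and> w ! b = c \<or> b = Suc d \<and> w ! d = c)"
      using Cons.prems by (subst sum.delta) auto
    finally show ?thesis .
  qed
  moreover have "walks w (rev (c # x)) a b
      = (\<Sum>d\<le>length w. walks w (rev x) a d * walks w [c] d b)"
    using walks_append[OF Cons.prems(1)] by simp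
  ultimately show ?case
    using Cons.IH Cons.prems by (simp add: mult.commute)
qed

text \<open>
  A walk of \<open>n\<close> steps that advances by at least \<open>n\<close> never turns back, so it must read off the letters
  of \<open>w\<close> in order. This is what lets the corner entry of the matrix detect a single word.
\<close>

lemma walks_straight:
  assumes "a + length x \<le> length w" "a + length x \<le> b" "b \<le> length w"
  shows "walks w x a b = of_bool (b = a + length x \<and> x = take (length x) (drop a w))"
  using assms
proof (induction x arbitrary: a)
  case Nil
  then show ?case by simp
next
  case (Cons c x)
  have backward: "walks w x d b = 0" if "a = Suc d" for d
    using Cons.IH[of d] Cons.prems that by auto
  have dr: "drop a w = w ! a # drop (Suc a) w"
    using Cons.prems by (simp add: Cons_nth_drop_Suc)
  have "walks w (c # x) a b
      = (\<Sum>d\<le>length w. if d = Suc a then of_bool (w ! a = c) * walks w x d b else 0)"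
    unfolding walks.simps by (rule sum.cong) (auto simp: backward)
  also have "\<dots> = of_bool (w ! a = c) * walks w x (Suc a) b"
    using Cons.prems by simp
  also have "\<dots> = of_bool (b = a + length (c # x) \<and> c # x = take (length (c # x)) (drop a w))"
    using Cons.IH[of "Suc a"] Cons.prems by (auto simp: dr)
  finally show ?case .
qed

text \<open>The trace of the matrix of \<open>x\<close>.\<close>

definition closed_walks :: "letter list \<Rightarrow> letter list \<Rightarrow> real" where
  "closed_walks w x = (\<Sum>a\<le>length w. walks w x a a)"

lemma closed_walks_append:
  "closed_walks w (x @ y) = (\<Sum>a\<le>length w. \<Sum>b\<le>length w. walks w x a b * walks w y b a)"
  by (simp add: closed_walks_def walks_append)

lemma closed_walks_commute: "closed_walks w (x @ y) = closed_walks w (y @ x)"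
  unfolding closed_walks_append by (subst sum.swap) (simp add: mult.commute)

lemma closed_walks_rev_append:
  "closed_walks w (rev x @ y) = (\<Sum>a\<le>length w. \<Sum>b\<le>length w. walks w x b a * walks w y b a)"
  by (simp add: closed_walks_append walks_rev)

lemma letters_add [simp]: "letters (u + v) = letters u @ letters v"
  by (simp add: plus_word_def)

lemma letters_word_rev [simp]: "letters (word_rev u) = rev (letters u)"
  by (simp add: word_rev_def)

text \<open>
  Take \<open>w\<close> with the most letters \<open>c\<close> among all words of the \<open>f\<^sub>i\<close>, and the longest of these. The
  trace of the matrices on the path of \<open>w\<close>, restricted to the words with \<open>2 * M\<close> letters \<open>c\<close>, is still
  invariant under cyclic shifts, and by maximality of \<open>M\<close> it turns the Hermitian squares into a sum
  of squares of matrix entries. One of these entries is the coefficient of \<open>w\<close>.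
\<close>

lemma degree_bound:
  assumes cyc: "cyclically_equivalent s (\<Sum>i<N. star (f i) * f i)"
    and homogeneous: "\<And>x. x \<in> Poly_Mapping.keys s \<Longrightarrow> count_list (letters x) c = 2 * D"
    and j: "j < (N::nat)" and u: "u \<in> Poly_Mapping.keys (f j)"
  shows "count_list (letters u) c \<le> D"
proof (rule ccontr)
  assume "\<not> count_list (letters u) c \<le> D"
  define B where "B = (\<Union>i<N. Poly_Mapping.keys (f i))"
  define cnt where "cnt = (\<lambda>x. count_list (letters x) c)"
  define M where "M = Max (cnt ` B)"
  define C where "C = {x \<in> B. cnt x = M}"
  have finB: "finite B" and uB: "u \<in> B"
    using j u by (auto simp: B_def)
  have cntM: "cnt x \<le> M" if "x \<in> B" for x
    unfolding M_def using that finB by simp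
  have "D < M"
    using cntM[OF uB] \<open>\<not> count_list (letters u) c \<le> D\<close> by (simp add: cnt_def)
  have "M \<in> cnt ` B"
    unfolding M_def using finB uB by (intro Max_in) auto
  then have "C \<noteq> {}" "finite C"
    using finB by (auto simp: C_def)
  then obtain w where wC: "w \<in> C" and wmax: "\<And>x. x \<in> C \<Longrightarrow> length (letters x) \<le> length (letters w)"
    using Max_in[of "(\<lambda>x. length (letters x)) ` C"] Max_ge[of "(\<lambda>x. length (letters x)) ` C"]
    by (metis (no_types, lifting) finite_imageI imageE image_eqI image_is_empty)
  define n where "n = length (letters w)"
  define R where "R = (\<lambda>x. walks (letters w) (letters x))"
  define \<phi> where "\<phi> = (\<lambda>x. of_bool (cnt x = 2 * M) * closed_walks (letters w) (letters x))"
  define Q where "Q = (\<lambda>i a b. \<Sum>x\<in>Poly_Mapping.keys (f i).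
    Poly_Mapping.lookup (f i) x * (of_bool (cnt x = M) * R x b a))"
  have trace: "\<phi> (x + y) = \<phi> (y + x)" for x y
    by (simp add: \<phi>_def cnt_def closed_walks_commute add.commute)
  have square: "(\<Sum>x\<in>Poly_Mapping.keys (f i). \<Sum>y\<in>Poly_Mapping.keys (f i).
      Poly_Mapping.lookup (f i) x * Poly_Mapping.lookup (f i) y * \<phi> (word_rev x + y))
    = (\<Sum>a\<le>n. \<Sum>b\<le>n. (Q i a b)\<^sup>2)" if "i < N" for i
  proof -
    have phi: "\<phi> (word_rev x + y)
        = (\<Sum>a\<le>n. \<Sum>b\<le>n. (of_bool (cnt x = M) * R x b a) * (of_bool (cnt y = M) * R y b a))"
      if "x \<in> Poly_Mapping.keys (f i)" "y \<in> Poly_Mapping.keys (f i)" for x y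
    proof -
      \<comment> \<open>Both counts are at most \<open>M\<close>, so they can add up to \<open>2 * M\<close> only if both are maximal: the
        restriction to one degree splits as a product.\<close>
      have "cnt x \<le> M" "cnt y \<le> M"
        using cntM that \<open>i < N\<close> by (auto simp: B_def)
      moreover have "cnt (word_rev x + y) = cnt x + cnt y"
        by (simp add: cnt_def)
      ultimately have "(cnt (word_rev x + y) = 2 * M) = (cnt x = M \<and> cnt y = M)"
        by linarith
      then show ?thesis
        by (simp add: \<phi>_def closed_walks_rev_append n_def R_def)
    qed
    let ?t = "\<lambda>x a b. Poly_Mapping.lookup (f i) x * (of_bool (cnt x = M) * R x b a)"
    have "(\<Sum>x\<in>Poly_Mapping.keys (f i). \<Sum>y\<in>Poly_Mapping.keys (f i).
        Poly_Mapping.lookup (f i) x * Poly_Mapping.lookup (f i) y * \<phi> (word_rev x + y))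
      = (\<Sum>x\<in>Poly_Mapping.keys (f i). \<Sum>y\<in>Poly_Mapping.keys (f i). \<Sum>a\<le>n. \<Sum>b\<le>n. ?t x a b * ?t y a b)"
      by (intro sum.cong refl) (simp add: phi sum_distrib_left mult_ac)
    also have "\<dots> = (\<Sum>x\<in>Poly_Mapping.keys (f i). \<Sum>a\<le>n. \<Sum>y\<in>Poly_Mapping.keys (f i). \<Sum>b\<le>n. ?t x a b * ?t y a b)"
      by (intro sum.cong refl sum.swap)
    also have "\<dots> = (\<Sum>a\<le>n. \<Sum>x\<in>Poly_Mapping.keys (f i). \<Sum>y\<in>Poly_Mapping.keys (f i). \<Sum>b\<le>n. ?t x a b * ?t y a b)"
      by (rule sum.swap)
    also have "\<dots> = (\<Sum>a\<le>n. \<Sum>x\<in>Poly_Mapping.keys (f i). \<Sum>b\<le>n. \<Sum>y\<in>Poly_Mapping.keys (f i). ?t x a b * ?t y a b)"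
      by (intro sum.cong refl sum.swap)
    also have "\<dots> = (\<Sum>a\<le>n. \<Sum>b\<le>n. \<Sum>x\<in>Poly_Mapping.keys (f i). \<Sum>y\<in>Poly_Mapping.keys (f i). ?t x a b * ?t y a b)"
      by (intro sum.cong refl sum.swap)
    also have "\<dots> = (\<Sum>a\<le>n. \<Sum>b\<le>n. (Q i a b)\<^sup>2)"
      by (simp add: Q_def power2_eq_square sum_product)
    finally show ?thesis .
  qed
  have "pairing \<phi> s = 0"
    unfolding pairing_def \<phi>_def using homogeneous \<open>D < M\<close> by (intro sum.neutral) (auto simp: cnt_def)
  then have zero: "(\<Sum>i<N. \<Sum>a\<le>n. \<Sum>b\<le>n. (Q i a b)\<^sup>2) = 0"
    using pairing_cyclic_hermitian[of \<phi>, OF trace cyc] square by simp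
  obtain i where i: "i < N" "w \<in> Poly_Mapping.keys (f i)"
    using wC by (auto simp: C_def B_def)
  have "(\<Sum>a\<le>n. \<Sum>b\<le>n. (Q i a b)\<^sup>2) = 0"
    using zero i by (subst (asm) sum_nonneg_eq_0_iff) (auto intro!: sum_nonneg)
  then have "(\<Sum>b\<le>n. (Q i n b)\<^sup>2) = 0"
    by (subst (asm) sum_nonneg_eq_0_iff) (auto intro!: sum_nonneg)
  then have "Q i n 0 = 0"
    by (subst (asm) sum_nonneg_eq_0_iff) auto
  moreover have "Q i n 0 = Poly_Mapping.lookup (f i) w"
  proof -
    have "Q i n 0 = (\<Sum>x\<in>Poly_Mapping.keys (f i). if x = w then Poly_Mapping.lookup (f i) x else 0)"
      unfolding Q_def
    proof (intro sum.cong refl)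
      fix x assume x: "x \<in> Poly_Mapping.keys (f i)"
      show "Poly_Mapping.lookup (f i) x * (of_bool (cnt x = M) * R x 0 n)
        = (if x = w then Poly_Mapping.lookup (f i) x else 0)"
      proof (cases "cnt x = M")
        case True
        \<comment> \<open>This is where \<open>w\<close> must be longest: \<open>x\<close> has no letters to spare for a detour.\<close>
        then have "length (letters x) \<le> n"
          using wmax[of x] x i by (auto simp: C_def B_def n_def)
        then have "R x 0 n = of_bool (x = w)"
          unfolding R_def n_def by (subst walks_straight) (auto intro: word.expand)
        then show ?thesis using True by simp
      next
        case False
        then show ?thesis using wC by (auto simp: C_def)
      qed
    qed
    then show ?thesis using i by simp
  qed
  ultimately show False
    using i by (simp add: in_keys_iff)
qed

section \<open>Rotations of words in the squares of the generators\<close>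

definition rotation_count :: "letter list \<Rightarrow> word \<Rightarrow> real" where
  "rotation_count W x = (\<Sum>t<length W. of_bool (rotate t W = letters x))"

lemma sum_rotate_shift:
  fixes F :: "'a list \<Rightarrow> real"
  shows "(\<Sum>t<length W. F (rotate (t + r) W)) = (\<Sum>t<length W. F (rotate t W))"
proof (induction r)
  case 0
  show ?case by simp
next
  case (Suc r)
  define g where "g = (\<lambda>t. F (rotate (t + r) W))"
  have "rotate (length W + r) W = rotate r W"
    by (metis mod_add_self1 rotate_conv_mod)
  then have "g (length W) = g 0"
    by (simp add: g_def)
  moreover have "g 0 + (\<Sum>t<length W. g (Suc t)) = (\<Sum>t<length W. g t) + g (length W)"
    using sum.lessThan_Suc_shift[of g "length W"] by simp
  ultimately have "(\<Sum>t<length W. g (Suc t)) = (\<Sum>t<length W. g t)"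
    by simp
  then show ?case using Suc by (simp add: g_def)
qed

text \<open>
  Rotating \<open>u @ v\<close> by the length of \<open>u\<close> gives \<open>v @ u\<close>, so the two counts differ by a shift of the
  summation index modulo the length of \<open>W\<close>.
\<close>

lemma rotation_count_commute: "rotation_count W (u + v) = rotation_count W (v + u)"
proof -
  let ?u = "letters u" and ?v = "letters v"
  have eq: "rotate (t + length ?u) W = ?v @ ?u \<longleftrightarrow> rotate t W = ?u @ ?v" for t
  proof
    assume a: "rotate (t + length ?u) W = ?v @ ?u"
    then have len: "length W = length ?u + length ?v"
      by (metis add.commute length_append length_rotate)
    have "?u @ ?v = rotate (length ?v) (rotate (t + length ?u) W)"
      by (simp add: a rotate_append)
    also have "\<dots> = rotate (t + length W) W"
      by (simp add: rotate_rotate len ac_simps)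
    also have "\<dots> = rotate t W"
      by (metis mod_add_self2 rotate_conv_mod)
    finally show "rotate t W = ?u @ ?v" ..
  next
    assume "rotate t W = ?u @ ?v"
    then have "rotate (length ?u) (rotate t W) = ?v @ ?u"
      by (simp add: rotate_append)
    then show "rotate (t + length ?u) W = ?v @ ?u"
      by (simp add: rotate_rotate add.commute)
  qed
  show ?thesis
    using sum_rotate_shift[of "\<lambda>z. of_bool (z = ?v @ ?u)" "length ?u" W]
    by (simp add: rotation_count_def eq)
qed

text \<open>The word in \<open>X\<close> and \<open>Y\<close> that a formal word in \<open>A = X\<^sup>2\<close> and \<open>B = Y\<^sup>2\<close> stands for.\<close>

definition doubled :: "bool list \<Rightarrow> letter list" where
  "doubled w = concat (map (\<lambda>b. if b then [LY, LY] else [LX, LX]) w)"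

lemma doubled_simps [simp]:
  "doubled [] = []"
  "doubled (b # w) = (if b then [LY, LY] else [LX, LX]) @ doubled w"
  "doubled (v @ w) = doubled v @ doubled w"
  by (simp_all add: doubled_def)

lemma doubled_replicate [simp]:
  "doubled (replicate m True) = replicate (2 * m) LY"
  "doubled (replicate m False) = replicate (2 * m) LX"
  by (induction m) simp_all

lemma doubled_rev: "doubled (rev w) = rev (doubled w)"
  by (induction w) simp_all

lemma length_doubled [simp]: "length (doubled w) = 2 * length w"
  by (induction w) simp_all

lemma count_doubled:
  "count_list (doubled w) LY = 2 * count_list w True"
  "count_list (doubled w) LX = 2 * count_list w False"
  by (induction w) simp_all

lemma nth_doubled: "i < 2 * length w \<Longrightarrow> doubled w ! i = (if w ! (i div 2) then LY else LX)"
proof (induction w arbitrary: i)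
  case Nil
  then show ?case by simp
next
  case (Cons b w)
  consider "i = 0" | "i = 1" | j where "i = Suc (Suc j)"
    by (metis One_nat_def not0_implies_Suc)
  then show ?case
    using Cons by cases auto
qed

lemma inj_doubled: "inj doubled"
proof (rule injI)
  fix v w show "doubled v = doubled w \<Longrightarrow> v = w"
    by (induction v arbitrary: w; case_tac w) (auto split: if_splits)
qed

lemma rotate_doubled: "rotate (2 * s) (doubled w) = doubled (rotate s w)"
proof (induction s)
  case (Suc s)
  have "rotate1 (rotate1 (doubled w)) = doubled (rotate1 w)" for w
    by (cases w) simp_all
  then show ?case using Suc by simp
qed simp

text \<open>
  A doubled word agrees at positions \<open>2 * j\<close> and \<open>2 * j + 1\<close>. If an odd rotation were doubled too, then
  also \<open>2 * j + 1\<close> and \<open>2 * j + 2\<close> would agree, and the word would be constant.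
\<close>

lemma rotate_doubled_odd:
  assumes "odd t" "True \<in> set w" "False \<in> set w"
  shows "rotate t (doubled w) \<noteq> doubled w'"
proof
  assume eq: "rotate t (doubled w) = doubled w'"
  define N where "N = 2 * length w"
  have len: "length w' = length w"
    using arg_cong[OF eq, of length] by simp
  define z where "z = (\<lambda>i. doubled w ! (i mod N))"
  have N: "N > 0" using assms(2) by (auto simp: N_def)
  have even_step: "z (Suc i) = z i" if "even i" for i
  proof -
    have "even (i mod N)" using that by (simp add: N_def dvd_mod_iff)
    moreover have "Suc i mod N = Suc (i mod N)"
      using N that \<open>even (i mod N)\<close>
      by (simp add: mod_Suc N_def) (metis dvd_triv_left even_Suc)
    ultimately show ?thesis
      using N mod_less_divisor[OF N, of i] mod_less_divisor[OF N, of "Suc i"]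
      by (simp add: z_def nth_doubled N_def)
  qed
  have odd_step: "z (Suc i) = z i" if "odd i" for i
  proof -
    have rot: "doubled w' ! j = z (t + j)" if "j < N" for j
      using nth_rotate[of j "doubled w" t] that eq by (simp add: z_def N_def)
    \<comment> \<open>\<open>j\<close> is \<open>i - t\<close> modulo \<open>N\<close>; the multiple of \<open>t\<close> keeps the subtraction from being truncated.\<close>
    define j where "j = (i + N * t - t) mod N"
    have "t \<le> N * t" using N by simp
    then have ev: "even (i + N * t - t)"
      using \<open>odd i\<close> assms(1) by (simp add: N_def)
    then have "even j" by (simp add: j_def N_def dvd_mod_iff)
    have "j < N" using N by (simp add: j_def)
    then have "Suc j < N"
      using \<open>even j\<close> by (simp add: N_def) presburger
    have "(t + j) mod N = (t + (i + N * t - t)) mod N"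
      by (simp add: j_def mod_simps)
    also have "t + (i + N * t - t) = i + N * t"
      using \<open>t \<le> N * t\<close> by linarith
    finally have tj: "(t + j) mod N = i mod N" by simp
    then have "(t + Suc j) mod N = Suc i mod N"
      by (metis add_Suc_right mod_Suc_eq)
    then have "z (Suc i) = doubled w' ! Suc j" "z i = doubled w' ! j"
      using rot[of j] rot[of "Suc j"] \<open>j < N\<close> \<open>Suc j < N\<close> tj by (simp_all add: z_def)
    then show ?thesis
      using \<open>even j\<close> \<open>Suc j < N\<close> len by (simp add: nth_doubled N_def)
  qed
  have const: "z i = z 0" for i
    by (induction i) (use even_step odd_step in metis)+
  have "w ! i = w ! 0" if "i < length w" for i
  proof -
    have "z (2 * i) = z 0" by (rule const)
    moreover have "z (2 * i) = (if w ! i then LY else LX)"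
      using that nth_doubled[of "2 * i" w] by (simp add: z_def N_def)
    moreover have "z 0 = (if w ! 0 then LY else LX)"
      using that nth_doubled[of 0 w] by (cases w) (simp_all add: z_def N_def)
    ultimately show ?thesis by (simp split: if_splits)
  qed
  then show False
    using assms(2,3) by (metis in_set_conv_nth)
qed

lemma word_value_doubled:
  "word_value (ncX ^ 2) (ncY ^ 2) w = Poly_Mapping.single (Word (doubled w)) 1"
proof (induction w)
  case Nil
  show ?case by (simp add: word_value_def zero_word_def[symmetric])
next
  case (Cons b w)
  then show ?case
    by (auto simp: word_value_def ncX_def ncY_def power2_eq_square mult_single plus_word_def)
qed

lemma S_eq:
  "S m j (ncX ^ 2) (ncY ^ 2)
    = (\<Sum>w | length w = m \<and> count_list w True = j. Poly_Mapping.single (Word (doubled w)) 1)"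
  by (simp add: S_def word_value_doubled)

lemma keys_S:
  assumes "x \<in> Poly_Mapping.keys (S m j (ncX ^ 2) (ncY ^ 2) :: ncpoly)"
  shows "\<exists>w. x = Word (doubled w) \<and> length w = m \<and> count_list w True = j"
proof -
  have "x \<in> (\<Union>w\<in>{w. length w = m \<and> count_list w True = j}.
      Poly_Mapping.keys (Poly_Mapping.single (Word (doubled w)) (1::real)))"
    using assms unfolding S_eq by (rule subsetD[OF keys_sum])
  then show ?thesis by (auto split: if_splits)
qed

lemma count_list_rotate [simp]: "count_list (rotate s w) x = count_list w x"
proof (induction s)
  case (Suc s)
  have "count_list (rotate1 v) x = count_list v x" for v :: "'a list"
    by (cases v) simp_all
  then show ?case using Suc by simp
qed simp

text \<open>
  All coefficients of \<open>S\<close> are \<open>0\<close> or \<open>1\<close>. Of the \<open>2 * m\<close> rotations of a doubled word exactly the even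
  ones are words of \<open>S\<close>.
\<close>

lemma pairing_rotation_count_S:
  assumes w: "length w = m" "count_list w True = j" and "0 < j" "j < m"
  shows "pairing (rotation_count (doubled w)) (S m j (ncX ^ 2) (ncY ^ 2)) = real m"
proof -
  let ?I = "{w. length w = m \<and> count_list w True = j}"
  have mem: "True \<in> set w" "False \<in> set w"
  proof -
    show "True \<in> set w" using w \<open>0 < j\<close> by (metis count_notin less_irrefl)
    have "count_list w True + count_list w False = length w"
      by (induction w) auto
    then show "False \<in> set w" using w \<open>j < m\<close> by (metis add.right_neutral count_notin less_irrefl)
  qed
  have one: "(\<Sum>v\<in>?I. of_bool (rotate t (doubled w) = doubled v)) = (of_bool (even t) :: real)" for t
  proof (cases "even t")
    case True
    then obtain s where s: "t = 2 * s" by blast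
    have "(\<Sum>v\<in>?I. of_bool (rotate t (doubled w) = doubled v))
        = (\<Sum>v\<in>?I. if v = rotate s w then 1 else (0::real))"
      by (intro sum.cong refl) (auto simp: s rotate_doubled inj_eq[OF inj_doubled])
    also have "\<dots> = 1"
      using finite_S_index[of m j] w by (simp add: sum.delta)
    finally show ?thesis using True by simp
  next
    case False
    then show ?thesis using rotate_doubled_odd[OF False mem] by simp
  qed
  have "(\<Sum>t<2 * r. of_bool (even t)) = real r" for r
    by (induction r) simp_all
  moreover have "pairing (rotation_count (doubled w)) (S m j (ncX ^ 2) (ncY ^ 2))
      = (\<Sum>t<2 * m. \<Sum>v\<in>?I. of_bool (rotate t (doubled w) = doubled v))"
    unfolding S_eq by (subst sum.swap) (simp add: pairing_sum rotation_count_def w)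
  ultimately show ?thesis by (simp add: one)
qed

section \<open>Gram entries and balanced cuts\<close>

lemma length_letters_count: "length x = count_list x LX + count_list x LY"
proof (induction x)
  case (Cons c x)
  then show ?case by (cases c) simp_all
qed simp

lemma bool_count: "length w = count_list w True + count_list w False"
  by (induction w) auto

locale hermitian_decomposition =
  fixes k l N :: nat and f :: "nat \<Rightarrow> ncpoly"
  assumes k_pos: "0 < k" and l_pos: "0 < l"
    and decomposition:
      "cyclically_equivalent (S (2 * (l + k)) (2 * k) (ncX ^ 2) (ncY ^ 2)) (\<Sum>i<N. star (f i) * f i)"
begin

text \<open>
  A cyclic word can be cut at opposite places in two orders, which yield a pair of words and the pair
  of their reversals. Putting both into one inner product makes each cut contribute a single entry.
\<close>

definition gram :: "letter list \<Rightarrow> letter list \<Rightarrow> real" where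
  "gram x y = (\<Sum>i<N. Poly_Mapping.lookup (f i) (Word x) * Poly_Mapping.lookup (f i) (Word y)
     + Poly_Mapping.lookup (f i) (Word (rev x)) * Poly_Mapping.lookup (f i) (Word (rev y)))"

lemma degrees:
  assumes "i < N" "u \<in> Poly_Mapping.keys (f i)"
  shows "count_list (letters u) LX \<le> 2 * l" "count_list (letters u) LY \<le> 2 * k"
proof -
  have homogeneous: "count_list (letters x) LX = 2 * (2 * l) \<and> count_list (letters x) LY = 2 * (2 * k)"
    if x: "x \<in> Poly_Mapping.keys (S (2 * (l + k)) (2 * k) (ncX ^ 2) (ncY ^ 2) :: ncpoly)" for x
  proof -
    obtain w where w: "x = Word (doubled w)" "length w = 2 * (l + k)" "count_list w True = 2 * k"
      using keys_S[OF x] by blast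
    then show ?thesis using bool_count[of w] by (simp add: count_doubled)
  qed
  show "count_list (letters u) LX \<le> 2 * l" "count_list (letters u) LY \<le> 2 * k"
    by (rule degree_bound[OF decomposition _ assms]; simp add: homogeneous)+
qed

lemma coefficient_unbalanced:
  assumes "i < N" "length x = 2 * (l + k)" "count_list x LX \<noteq> 2 * l"
  shows "Poly_Mapping.lookup (f i) (Word x) = 0"
proof (rule ccontr)
  assume "Poly_Mapping.lookup (f i) (Word x) \<noteq> 0"
  then have "Word x \<in> Poly_Mapping.keys (f i)" by (simp add: in_keys_iff)
  then show False
    using degrees[OF assms(1), of "Word x"] length_letters_count[of x] assms by simp
qed

lemma count_rev_list [simp]: "count_list (rev x) c = count_list x c"
  by (induction x) simp_all

lemma gram_unbalanced:
  assumes "length x = 2 * (l + k)" "count_list x LX \<noteq> 2 * l"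
  shows "gram x y = 0"
  using assms by (simp add: gram_def coefficient_unbalanced)

text \<open>
  By the degree bounds no word of \<open>f\<^sub>i\<close> is longer than \<open>2 * (l + k)\<close>, so a word of twice this length
  splits only in the middle.
\<close>

lemma cut_sum:
  assumes i: "i < N" and R: "length R = 4 * (l + k)" "count_list R LX = 4 * l"
  shows "(\<Sum>u\<in>Poly_Mapping.keys (f i). \<Sum>v\<in>Poly_Mapping.keys (f i).
      Poly_Mapping.lookup (f i) u * Poly_Mapping.lookup (f i) v * of_bool (R = rev (letters u) @ letters v))
    = Poly_Mapping.lookup (f i) (Word (rev (take (2 * (l + k)) R)))
      * Poly_Mapping.lookup (f i) (Word (drop (2 * (l + k)) R))" (is "?L = ?r * ?s")
proof -
  let ?a = "Word (rev (take (2 * (l + k)) R))" and ?b = "Word (drop (2 * (l + k)) R)"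
  have cut: "R = rev (letters u) @ letters v \<longleftrightarrow> u = ?a \<and> v = ?b"
    if uv: "u \<in> Poly_Mapping.keys (f i)" "v \<in> Poly_Mapping.keys (f i)" for u v
  proof
    assume eq: "R = rev (letters u) @ letters v"
    have "length (letters u) \<le> 2 * (l + k)" "length (letters v) \<le> 2 * (l + k)"
      using degrees[OF i uv(1)] degrees[OF i uv(2)]
        length_letters_count[of "letters u"] length_letters_count[of "letters v"] by simp_all
    moreover have "length (letters u) + length (letters v) = 4 * (l + k)"
      using eq R by simp
    ultimately have "length (letters u) = 2 * (l + k)" by linarith
    then show "u = ?a \<and> v = ?b" using eq by simp
  next
    assume "u = ?a \<and> v = ?b"
    then show "R = rev (letters u) @ letters v" by simp
  qed
  have "?L = (\<Sum>u\<in>Poly_Mapping.keys (f i). \<Sum>v\<in>Poly_Mapping.keys (f i).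
      (if u = ?a then Poly_Mapping.lookup (f i) u else 0) * (if v = ?b then Poly_Mapping.lookup (f i) v else 0))"
    by (intro sum.cong refl) (simp add: cut)
  also have "\<dots> = ?r * ?s"
    unfolding sum_product[symmetric] by (simp add: sum.delta in_keys_iff)
  finally show ?thesis .
qed

text \<open>
  The functional \<open>rotation_count (h @ v)\<close> applied to the decomposition. The rotation by \<open>t\<close> is cut in
  the middle into \<open>drop t h @ take t v\<close> and \<open>drop t v @ take t h\<close>; the rotations by \<open>t\<close> and by half a
  turn more make up one entry of \<open>gram\<close>.
\<close>

lemma gram_cuts:
  assumes a: "length a = l + k" "count_list a True = k"
    and b: "length b = l + k" "count_list b True = k"
  defines "h \<equiv> rev (doubled a)" and "v \<equiv> doubled b"
  shows "(\<Sum>t<2 * (l + k). gram (rev (drop t h @ take t v)) (drop t v @ take t h)) = 2 * real (l + k)"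
proof -
  let ?n = "2 * (l + k)"
  let ?c = "\<lambda>i x. Poly_Mapping.lookup (f i) (Word x)"
  define w where "w = rev a @ b"
  have W: "doubled w = h @ v" by (simp add: w_def h_def v_def doubled_rev)
  have len: "length h = ?n" "length v = ?n" by (simp_all add: h_def v_def a b)
  have cnt: "count_list (h @ v) LX = 4 * l"
    using bool_count[of a] bool_count[of b] a b by (simp add: h_def v_def count_doubled)
  define G where "G = (\<lambda>i t. ?c i (rev (take ?n (rotate t (h @ v)))) * ?c i (drop ?n (rotate t (h @ v))))"
  have "(\<Sum>i<N. \<Sum>u\<in>Poly_Mapping.keys (f i). \<Sum>v'\<in>Poly_Mapping.keys (f i).
      Poly_Mapping.lookup (f i) u * Poly_Mapping.lookup (f i) v' * rotation_count (doubled w) (word_rev u + v'))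
    = pairing (rotation_count (doubled w)) (S ?n (2 * k) (ncX ^ 2) (ncY ^ 2))"
    by (rule pairing_cyclic_hermitian[of "rotation_count (doubled w)", OF rotation_count_commute decomposition])
  also have "\<dots> = real ?n"
    by (rule pairing_rotation_count_S) (use a b k_pos l_pos in \<open>simp_all add: w_def\<close>)
  finally have total: "(\<Sum>i<N. \<Sum>u\<in>Poly_Mapping.keys (f i). \<Sum>v'\<in>Poly_Mapping.keys (f i).
      Poly_Mapping.lookup (f i) u * Poly_Mapping.lookup (f i) v' * rotation_count (doubled w) (word_rev u + v'))
    = real ?n" .
  have inner: "(\<Sum>u\<in>Poly_Mapping.keys (f i). \<Sum>v'\<in>Poly_Mapping.keys (f i).
      Poly_Mapping.lookup (f i) u * Poly_Mapping.lookup (f i) v' * rotation_count (doubled w) (word_rev u + v'))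
    = (\<Sum>t<?n + ?n. G i t)" if "i < N" for i
  proof -
    have "(\<Sum>u\<in>Poly_Mapping.keys (f i). \<Sum>v'\<in>Poly_Mapping.keys (f i).
        Poly_Mapping.lookup (f i) u * Poly_Mapping.lookup (f i) v' * rotation_count (doubled w) (word_rev u + v'))
      = (\<Sum>u\<in>Poly_Mapping.keys (f i). \<Sum>v'\<in>Poly_Mapping.keys (f i). \<Sum>t<?n + ?n.
        Poly_Mapping.lookup (f i) u * Poly_Mapping.lookup (f i) v'
          * of_bool (rotate t (h @ v) = rev (letters u) @ letters v'))"
      by (simp only: rotation_count_def W length_append len letters_add letters_word_rev sum_distrib_left)
    also have "\<dots> = (\<Sum>u\<in>Poly_Mapping.keys (f i). \<Sum>t<?n + ?n. \<Sum>v'\<in>Poly_Mapping.keys (f i).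
        Poly_Mapping.lookup (f i) u * Poly_Mapping.lookup (f i) v'
          * of_bool (rotate t (h @ v) = rev (letters u) @ letters v'))"
      by (intro sum.cong refl sum.swap)
    also have "\<dots> = (\<Sum>t<?n + ?n. \<Sum>u\<in>Poly_Mapping.keys (f i). \<Sum>v'\<in>Poly_Mapping.keys (f i).
        Poly_Mapping.lookup (f i) u * Poly_Mapping.lookup (f i) v'
          * of_bool (rotate t (h @ v) = rev (letters u) @ letters v'))"
      by (rule sum.swap)
    also have "\<dots> = (\<Sum>t<?n + ?n. G i t)"
      unfolding G_def
      by (intro sum.cong refl cut_sum that) (use len cnt in simp_all)
    finally show ?thesis .
  qed
  have half: "G i t + G i (?n + t)
      = ?c i (rev (drop t h @ take t v)) * ?c i (drop t v @ take t h)
        + ?c i (drop t h @ take t v) * ?c i (rev (drop t v @ take t h))" if "t < ?n" for i t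
  proof -
    have r1: "rotate t (h @ v) = (drop t h @ take t v) @ (drop t v @ take t h)"
      using rotate_append[of "take t h" "drop t h @ v"] rotate_drop_take[of t "h @ v"] that len by simp
    have "rotate (?n + t) (h @ v) = rotate t (v @ h)"
      using rotate_append[of h v] len by (metis add.commute rotate_rotate)
    then have r2: "rotate (?n + t) (h @ v) = (drop t v @ take t h) @ (drop t h @ take t v)"
      using rotate_drop_take[of t "v @ h"] that len by simp
    show ?thesis
      unfolding G_def r1 r2 using that len by (simp add: mult.commute)
  qed
  have split: "(\<Sum>t<m + m. g t) = (\<Sum>t<m. g t + g (m + t))" for m and g :: "nat \<Rightarrow> real"
  proof -
    have "(\<Sum>t<m + m. g t) = (\<Sum>t<m. g t) + (\<Sum>t=m..<m + m. g t)"
      using sum.atLeastLessThan_concat[of 0 m "m + m" g] by (simp add: atLeast0LessThan)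
    also have "(\<Sum>t=m..<m + m. g t) = (\<Sum>t<m. g (m + t))"
      using sum.shift_bounds_nat_ivl[of g 0 m m] by (simp add: atLeast0LessThan add.commute)
    finally show ?thesis by (simp add: sum.distrib)
  qed
  have "(\<Sum>t<?n. gram (rev (drop t h @ take t v)) (drop t v @ take t h))
      = (\<Sum>t<?n. \<Sum>i<N. G i t + G i (?n + t))"
    by (intro sum.cong refl) (simp only: gram_def half lessThan_iff rev_rev_ident)
  also have "\<dots> = (\<Sum>i<N. \<Sum>t<?n. G i t + G i (?n + t))"
    by (rule sum.swap)
  also have "\<dots> = (\<Sum>i<N. \<Sum>t<?n + ?n. G i t)"
    by (simp only: split)
  also have "\<dots> = real ?n"
    using total inner by simp
  finally show ?thesis by simp
qed

text \<open>
  The half \<open>drop t h @ take t v\<close> has the right number of letters \<open>X\<close> precisely if the prefixes of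
  length \<open>t\<close> of \<open>h\<close> and \<open>v\<close> contain equally many; every other cut has entry \<open>0\<close>.
\<close>

lemma gram_balanced_cuts:
  assumes a: "length a = l + k" "count_list a True = k"
    and b: "length b = l + k" "count_list b True = k"
    and T: "T \<subseteq> {..<2 * (l + k)}"
    and unbalanced: "\<And>t. \<lbrakk>t < 2 * (l + k); t \<notin> T\<rbrakk> \<Longrightarrow>
      count_list (take t (rev (doubled a))) LX \<noteq> count_list (take t (doubled b)) LX"
  shows "(\<Sum>t\<in>T. gram (rev (drop t (rev (doubled a)) @ take t (doubled b)))
      (drop t (doubled b) @ take t (rev (doubled a)))) = 2 * real (l + k)"
proof -
  let ?h = "rev (doubled a)" and ?v = "doubled b"
  have zero: "gram (rev (drop t ?h @ take t ?v)) (drop t ?v @ take t ?h) = 0"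
    if "t < 2 * (l + k)" "t \<notin> T" for t
  proof (rule gram_unbalanced)
    show "length (rev (drop t ?h @ take t ?v)) = 2 * (l + k)"
      using that a b by simp
    have "count_list (take t ?h) LX + count_list (drop t ?h) LX = count_list ?h LX"
      by (metis append_take_drop_id count_list_append)
    also have "\<dots> = 2 * l"
      using bool_count[of a] a by (simp add: count_doubled)
    finally have "count_list (take t ?h) LX + count_list (drop t ?h) LX = 2 * l" .
    then show "count_list (rev (drop t ?h @ take t ?v)) LX \<noteq> 2 * l"
      using unbalanced[OF that] by simp
  qed
  show ?thesis
    unfolding gram_cuts[OF a b, symmetric]
    by (rule sum.mono_neutral_left) (use T zero in auto)
qed

end

section \<open>Four words with contradictory Gram entries\<close>

definition blocks :: "nat \<Rightarrow> nat \<Rightarrow> nat \<Rightarrow> nat \<Rightarrow> bool list" where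
  "blocks a b c d = replicate a False @ replicate b True @ replicate c False @ replicate d True"

lemma count_list_replicate: "count_list (replicate m x) y = (if x = y then m else 0)"
  by (induction m) auto

lemma length_blocks [simp]: "length (blocks a b c d) = a + b + c + d"
  by (simp add: blocks_def)

lemma count_blocks [simp]: "count_list (blocks a b c d) True = b + d"
  by (simp add: blocks_def count_list_replicate)

lemma doubled_blocks:
  "doubled (blocks a b c d)
    = replicate (2 * a) LX @ replicate (2 * b) LY @ replicate (2 * c) LX @ replicate (2 * d) LY"
  by (simp add: blocks_def)

lemma count_prefix_blocks:
  "count_list (take t (doubled (blocks a b c d))) LX = min t (2 * a) + min (t - (2 * a + 2 * b)) (2 * c)"
  by (simp add: doubled_blocks count_list_replicate min.commute)

lemma count_prefix_rev_blocks:
  "count_list (take t (rev (doubled (blocks a b c d)))) LX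
    = min (t - 2 * d) (2 * c) + min (t - (2 * d + 2 * c + 2 * b)) (2 * a)"
  by (simp add: doubled_blocks count_list_replicate min.commute add.assoc)

context hermitian_decomposition
begin

lemma gram_trivial_cut:
  assumes "length a = l + k" "count_list a True = k" "length b = l + k" "count_list b True = k"
    and "\<And>t. \<lbrakk>0 < t; t < 2 * (l + k)\<rbrakk> \<Longrightarrow>
      count_list (take t (rev (doubled a))) LX \<noteq> count_list (take t (doubled b)) LX"
  shows "gram (doubled a) (doubled b) = 2 * real (l + k)"
  using gram_balanced_cuts[of a b "{0}"] assms k_pos by simp

lemma gram_nonneg: "0 \<le> gram x x"
  by (simp add: gram_def sum_nonneg)

lemma gram_rev: "gram (rev x) (rev y) = gram x y"
  by (simp add: gram_def add.commute)

text \<open>The squared distance of the two vectors is \<open>gram x x - 2 * gram x y + gram y y = 0\<close>.\<close>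

lemma gram_parallel:
  assumes "gram x x = c" "gram x y = c" "gram y y = c"
  shows "gram x z = gram y z"
proof -
  let ?c = "\<lambda>i x. Poly_Mapping.lookup (f i) (Word x)"
  have "(\<Sum>i<N. (?c i x - ?c i y)\<^sup>2 + (?c i (rev x) - ?c i (rev y))\<^sup>2)
      = gram x x - 2 * gram x y + gram y y"
    by (simp add: gram_def power2_eq_square algebra_simps sum.distrib sum_subtractf sum_distrib_left)
  then have "(\<Sum>i<N. (?c i x - ?c i y)\<^sup>2 + (?c i (rev x) - ?c i (rev y))\<^sup>2) = 0"
    using assms by simp
  then have "(?c i x - ?c i y)\<^sup>2 + (?c i (rev x) - ?c i (rev y))\<^sup>2 = 0" if "i < N" for i
    using that by (subst (asm) sum_nonneg_eq_0_iff) auto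
  then show ?thesis
    by (simp add: gram_def sum_power2_eq_zero_iff)
qed

text \<open>
  Substituting \<open>k = k' + 3\<close> and \<open>l = l' + 5\<close> removes the truncated differences from the exponents, so
  that the number of letters \<open>X\<close> in a prefix becomes an explicit piecewise linear function of its
  length. For the four pairs without extra balanced cuts the prefixes of the second word are strictly
  ahead; for \<open>d\<close> the lead changes exactly at \<open>4\<close> and at \<open>2 * (l + k) - 4\<close>.
\<close>

lemma decomposition_impossible:
  assumes k: "k \<ge> 3" and l: "l \<ge> 5"
  shows False
proof -
  obtain k' l' where k': "k = k' + 3" and l': "l = l' + 5"
    using k l by (metis add.commute le_Suc_ex)
  have size: "2 * (l + k) = 2 * l' + 2 * k' + 16"
    by (simp add: k' l')
  define e where "e = blocks (l' + 5) (k' + 3) 0 0"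
  define b where "b = blocks (l' + 3) (k' + 2) 2 1"
  define c where "c = blocks 1 2 (l' + 4) (k' + 1)"
  define d where "d = blocks 1 (k' + 2) (l' + 4) 1"
  let ?n = "2 * real (l + k)"
  have content_e: "length e = l + k" "count_list e True = k"
    and content_b: "length b = l + k" "count_list b True = k"
    and content_c: "length c = l + k" "count_list c True = k"
    and content_d: "length d = l + k" "count_list d True = k"
    by (simp_all add: e_def b_def c_def d_def k' l')
  have prefix:
      "count_list (take t (doubled e)) LX = min t (2 * l' + 10)"
      "count_list (take t (rev (doubled e))) LX = min (t - (2 * k' + 6)) (2 * l' + 10)"
      "count_list (take t (doubled b)) LX = min t (2 * l' + 6) + min (t - (2 * l' + 2 * k' + 10)) 4"
      "count_list (take t (rev (doubled b))) LX = min (t - 2) 4 + min (t - (2 * k' + 10)) (2 * l' + 6)"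
      "count_list (take t (doubled c)) LX = min t 2 + min (t - 6) (2 * l' + 8)"
      "count_list (take t (doubled d)) LX = min t 2 + min (t - (2 * k' + 6)) (2 * l' + 8)"
      "count_list (take t (rev (doubled d))) LX = min (t - 2) (2 * l' + 8) + min (t - (2 * l' + 2 * k' + 14)) 2"
    for t
    by (simp_all add: e_def b_def c_def d_def count_prefix_blocks count_prefix_rev_blocks algebra_simps)
  have ee: "gram (doubled e) (doubled e) = ?n"
  proof (rule gram_trivial_cut[OF content_e content_e])
    fix t assume t: "0 < t" "t < 2 * (l + k)"
    have "count_list (take t (rev (doubled e))) LX < count_list (take t (doubled e)) LX"
      unfolding prefix using t[unfolded size] by linarith
    then show "count_list (take t (rev (doubled e))) LX \<noteq> count_list (take t (doubled e)) LX"
      by simp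
  qed
  have eb: "gram (doubled e) (doubled b) = ?n"
  proof (rule gram_trivial_cut[OF content_e content_b])
    fix t assume t: "0 < t" "t < 2 * (l + k)"
    have "count_list (take t (rev (doubled e))) LX < count_list (take t (doubled b)) LX"
      unfolding prefix using t[unfolded size] by linarith
    then show "count_list (take t (rev (doubled e))) LX \<noteq> count_list (take t (doubled b)) LX"
      by simp
  qed
  have ec: "gram (doubled e) (doubled c) = ?n"
  proof (rule gram_trivial_cut[OF content_e content_c])
    fix t assume t: "0 < t" "t < 2 * (l + k)"
    have "count_list (take t (rev (doubled e))) LX < count_list (take t (doubled c)) LX"
      unfolding prefix using t[unfolded size] by linarith
    then show "count_list (take t (rev (doubled e))) LX \<noteq> count_list (take t (doubled c)) LX"
      by simp
  qed
  have bb: "gram (doubled b) (doubled b) = ?n"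
  proof (rule gram_trivial_cut[OF content_b content_b])
    fix t assume t: "0 < t" "t < 2 * (l + k)"
    have "count_list (take t (rev (doubled b))) LX < count_list (take t (doubled b)) LX"
      unfolding prefix using t[unfolded size] by linarith
    then show "count_list (take t (rev (doubled b))) LX \<noteq> count_list (take t (doubled b)) LX"
      by simp
  qed
  have bc: "gram (doubled b) (doubled c) = ?n"
    using gram_parallel[OF ee eb bb] ec by simp
  let ?h = "rev (doubled d)" and ?v = "doubled d" and ?m = "2 * l' + 2 * k' + 12"
  have unbalanced: "count_list (take t ?h) LX \<noteq> count_list (take t ?v) LX"
    if t: "t < 2 * (l + k)" "t \<notin> {0, 4, ?m}" for t
  proof -
    have bound: "t < 2 * l' + 2 * k' + 16"
      using t(1) unfolding size .
    consider "0 < t" "t < 4" | "4 < t" "t + 4 < 2 * l' + 2 * k' + 16" | "2 * l' + 2 * k' + 16 < t + 4"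
      using t by fastforce
    then show ?thesis
    proof cases
      case 1
      then have "count_list (take t ?h) LX < count_list (take t ?v) LX"
        unfolding prefix using bound by linarith
      then show ?thesis by simp
    next
      case 2
      then have "count_list (take t ?v) LX < count_list (take t ?h) LX"
        unfolding prefix by linarith
      then show ?thesis by simp
    next
      case 3
      then have "count_list (take t ?h) LX < count_list (take t ?v) LX"
        unfolding prefix using bound by linarith
      then show ?thesis by simp
    qed
  qed
  have cuts: "(\<Sum>t\<in>{0, 4, ?m}. gram (rev (drop t ?h @ take t ?v)) (drop t ?v @ take t ?h)) = ?n"
    by (rule gram_balanced_cuts[OF content_d content_d _ unbalanced]) (simp_all only: size, simp_all)
  \<comment> \<open>The word \<open>d\<close> both begins and ends with \<open>A B\<close>. Moving the cut in \<open>rev d @ d\<close> by these two letters,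
    in either direction, produces the halves \<open>rev d2 @ A B\<close> and \<open>d1 @ B A\<close> up to reversal, which are
    \<open>b\<close> and the reversal of \<open>c\<close>.\<close>
  define d1 where "d1 = replicate (k' + 1) True @ replicate (l' + 4) False @ [True]"
  define d2 where "d2 = False # replicate (k' + 2) True @ replicate (l' + 3) False"
  have d_splits: "d = [False, True] @ d1" "d = d2 @ [False, True]"
    by (simp_all add: d_def d1_def d2_def blocks_def replicate_append_same numeral_eq_Suc)
  have bc_splits: "b = rev d2 @ [False, True]" "c = [False, True] @ rev d1"
    by (simp_all add: b_def c_def d1_def d2_def blocks_def replicate_append_same
        replicate_app_Cons_same numeral_eq_Suc)
  have lengths: "length (doubled d1) = ?m" "length (doubled d2) = ?m"
    by (simp_all add: d1_def d2_def)
  have h_splits: "?h = [LY, LY, LX, LX] @ rev (doubled d2)" "?h = rev (doubled d1) @ [LY, LY, LX, LX]"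
    using arg_cong[OF d_splits(2), of "\<lambda>w. rev (doubled w)"]
      arg_cong[OF d_splits(1), of "\<lambda>w. rev (doubled w)"] by simp_all
  have v_splits: "?v = [LX, LX, LY, LY] @ doubled d1" "?v = doubled d2 @ [LX, LX, LY, LY]"
    using arg_cong[OF d_splits(1), of doubled] arg_cong[OF d_splits(2), of doubled] by simp_all
  have first: "take 4 ?h = [LY, LY, LX, LX]" "drop 4 ?h = rev (doubled d2)"
    unfolding h_splits(1) by simp_all
  have first': "take 4 ?v = [LX, LX, LY, LY]" "drop 4 ?v = doubled d1"
    unfolding v_splits(1) by simp_all
  have last: "drop ?m ?h = [LY, LY, LX, LX]" "take ?m ?h = rev (doubled d1)"
    unfolding h_splits(2) lengths(1)[symmetric] by simp_all
  have last': "drop ?m ?v = [LX, LX, LY, LY]" "take ?m ?v = doubled d2"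
    unfolding v_splits(2) lengths(2)[symmetric] by simp_all
  have cut1: "rev (drop 4 ?h @ take 4 ?v) = rev (doubled b)"
      "drop 4 ?v @ take 4 ?h = rev (doubled c)"
    by (simp_all only: first first') (simp_all add: bc_splits doubled_rev)
  have cut2: "rev (drop ?m ?h @ take ?m ?v) = doubled b"
      "drop ?m ?v @ take ?m ?h = doubled c"
    by (simp_all only: last last') (simp_all add: bc_splits doubled_rev)
  have "(\<Sum>t\<in>{0, 4, ?m}. g t) = g 0 + (g 4 + g ?m)" for g :: "nat \<Rightarrow> real"
    by simp
  then have "gram ?v ?v + 2 * gram (doubled b) (doubled c) = ?n"
    using cuts by (simp only: cut1 cut2 gram_rev) simp
  then show False
    using gram_nonneg[of ?v] bc k by simp
qed

end

theorem proposition2p4: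
  fixes k l :: nat
  assumes "k \<ge> 3" and "l \<ge> 5"
  shows "\<not> (\<exists>p. sum_hermitian_squares p \<and>
    cyclically_equivalent (S (2 * (l + k)) (2 * k) (ncX ^ 2) (ncY ^ 2)) p)"
proof
  assume "\<exists>p. sum_hermitian_squares p \<and>
    cyclically_equivalent (S (2 * (l + k)) (2 * k) (ncX ^ 2) (ncY ^ 2)) p"
  then obtain N :: nat and f where
    "cyclically_equivalent (S (2 * (l + k)) (2 * k) (ncX ^ 2) (ncY ^ 2)) (\<Sum>i<N. star (f i) * f i)"
    unfolding sum_hermitian_squares_def by blast
  then interpret hermitian_decomposition k l N f
    using assms by unfold_locales simp_all
  show False using assms by (rule decomposition_impossible)
qed

end
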